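(* Let $N\ge 0$, let $\mathbf A\in\mathbb R^{(N+1)\times(N+1)}$, let $1\le r\le N+1$ and let the ratio $\Delta t/\Delta x>0$ be given. The application of the rank-$r$ projector-splitting integrator to the Lax--Friedrichs discretization of $\partial_t\mathbf u(t,x)=-\mathbf A\,\partial_x\mathbf u(t,x)$, i.e. the scheme mapping $\mathbf u^n=\mathbf X^n\mathbf S^n\mathbf W^{n,T}$ to $\mathbf u^{n+1}=\mathbf u_{III}^{n+1}$ through \begin{align*} \mathbf u_{I}^{n+1} &= \left(\mathbf L^{(1)}\mathbf u^{n}_{I}-\mathbf L^{(2)}\mathbf u^{n}_{I}\mathbf{A}^T\right)\mathbf{W}^n\mathbf{W}^{n,T},\\ \mathbf u_{II}^{n+1} &=- \mathbf{X}^{n+1}\mathbf{X}^{n+1,T}\left((\mathbf L^{(1)}-2\mathbf I)\mathbf u^{n}_{II}-\mathbf L^{(2)}\mathbf u^{n}_{II}\mathbf{A}^T\right)\mathbf{W}^n\mathbf{W}^{n,T},\\ \mathbf u_{III}^{n+1} &= \mathbf{X}^{n+1}\mathbf{X}^{n+1,T}\left(\mathbf L^{(1)}\mathbf u^{n}_{III}-\mathbf L^{(2)}\mathbf u^{n}_{III}\mathbf{A}^T\right), \end{align*} with $\mathbf u_I^n=\mathbf u^n$, $\mathbf u_{II}^n=\mathbf u_I^{n+1}$, $\mathbf u_{III}^n=\mathbf u_{II}^{n+1}$, is $L^2$-unstable.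
   Context: The spatial domain $[-1,1]$ is divided into $N_x\ge r$ equidistant cells of width $\Delta x=2/N_x$, and $\Delta t>0$ is the time step size. Solutions are matrices in $\mathbb R^{N_x\times(N+1)}$, whose rows are indexed by the spatial cells; $\Vert\cdot\Vert_F$ is the Frobenius norm. The matrices $\mathbf L^{(1)},\mathbf L^{(2)}\in\mathbb R^{N_x\times N_x}$ act by $$(\mathbf L^{(1)}\mathbf v)_j=\tfrac12(\mathbf v_{j+1}+\mathbf v_{j-1}),\qquad (\mathbf L^{(2)}\mathbf v)_j=\tfrac{\Delta t}{2\Delta x}(\mathbf v_{j+1}-\mathbf v_{j-1}),$$ with the spatial index $j$ taken periodically (modulo $N_x$). The full (not low-rank) Lax--Friedrichs scheme with explicit Euler time stepping is $\mathbf u^{n+1}=\mathbf L^{(1)}\mathbf u^n-\mathbf L^{(2)}\mathbf u^n\mathbf A^T$. A rank-$r$ representation is $\mathbf u^n=\mathbf X^n\mathbf S^n\mathbf W^{n,T}$ with $\mathbf X^n\in\mathbb R^{N_x\times r}$ and $\mathbf W^n\in\mathbb R^{(N+1)\times r}$ having orthonormal columns and $\mathbf S^n\in\mathbb R^{r\times r}$; $\mathbf W^{n,T}$ denotes the transpose of $\mathbf W^n$, and similarly for other matrices. In the scheme, $\mathbf X^{n+1}\in\mathbb R^{N_x\times r}$ has orthonormal columns and is obtained from a QR decomposition $\mathbf K^{n+1}=\mathbf X^{n+1}\widetilde{\mathbf S}^n$ of $\mathbf K^{n+1}:=\mathbf u_I^{n+1}\mathbf W^n$ with $\widetilde{\mathbf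 S}^n\in\mathbb R^{r\times r}$. The scheme is called $L^2$-stable if $\Vert\mathbf u^{n+1}\Vert_F\le\Vert\mathbf u^n\Vert_F$ for every number of cells $N_x\ge r$ and every input $\mathbf u^n=\mathbf X^n\mathbf S^n\mathbf W^{n,T}$; it is called $L^2$-unstable if it is not $L^2$-stable. *)

theory Defs
  imports Complex_Main "Jordan_Normal_Form.Matrix"
begin

text \<open>
  Matrices are those of \<open>Jordan_Normal_Form.Matrix\<close>, because the number of cells is
  quantified inside the definition of stability.  Their rows and columns are numbered from 0,
  so the spatial cells are \<open>0, \<dots>, Nx - 1\<close>.
\<close>

definition frob_norm :: "real mat \<Rightarrow> real" where
  "frob_norm M = sqrt (\<Sum>i<dim_row M. \<Sum>j<dim_col M. (M $$ (i, j))\<^sup>2)"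

definition orthonormal_cols :: "real mat \<Rightarrow> bool" where
  "orthonormal_cols M \<longleftrightarrow>
     (\<forall>i<dim_col M. \<forall>j<dim_col M. col M i \<bullet> col M j = (if i = j then 1 else 0))"

text \<open>
  Reduced QR decomposition.  It is not unique: signs are free, and for a rank-deficient matrix
  even the column space of the first factor is.  A scheme therefore depends on the
  choice function \<open>qr\<close> that computes the two factors.
\<close>

definition is_QR :: "real mat \<Rightarrow> real mat \<Rightarrow> real mat \<Rightarrow> bool" where
  "is_QR K Q R \<longleftrightarrow>
     Q \<in> carrier_mat (dim_row K) (dim_col K) \<and> R \<in> carrier_mat (dim_col K) (dim_col K) \<and>
     orthonormal_cols Q \<and> upper_triangular R \<and> K = Q * R"

definition QR_routine :: "(real mat \<Rightarrow> real mat \<times> real mat) \<Rightarrow> bool" where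
  "QR_routine qr \<longleftrightarrow>
     (\<forall>K. dim_col K \<le> dim_row K \<longrightarrow> is_QR K (fst (qr K)) (snd (qr K)))"

definition cell_width :: "nat \<Rightarrow> real" where
  "cell_width Nx = 2 / real Nx"

text \<open>
  The periodic right neighbour of cell \<open>j\<close> is \<open>(j + 1) mod Nx\<close>, the left one
  \<open>(j + Nx - 1) mod Nx\<close>.  For \<open>Nx \<le> 2\<close> the two coincide, hence entries are
  sums (differences) of two indicators.
\<close>

definition L1 :: "nat \<Rightarrow> real mat" where
  "L1 Nx = mat Nx Nx (\<lambda>(j, k).
     1 / 2 * (of_bool (k = (j + 1) mod Nx) + of_bool (k = (j + Nx - 1) mod Nx)))"

definition L2 :: "nat \<Rightarrow> real \<Rightarrow> real mat" where
  "L2 Nx dt = mat Nx Nx (\<lambda>(j, k).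
     dt / (2 * cell_width Nx) *
       (of_bool (k = (j + 1) mod Nx) - of_bool (k = (j + Nx - 1) mod Nx)))"

text \<open>One time step of the projector-splitting integrator, started from \<open>X * S * W\<^sup>T\<close>.\<close>

definition psi_lax_friedrichs ::
  "real mat \<Rightarrow> (real mat \<Rightarrow> real mat \<times> real mat) \<Rightarrow>
   nat \<Rightarrow> real \<Rightarrow> real mat \<Rightarrow> real mat \<Rightarrow> real mat \<Rightarrow> real mat" where
  "psi_lax_friedrichs A qr Nx dt X S W =
    (let u = X * S * transpose_mat W;
         u1 = (L1 Nx * u - L2 Nx dt * u * transpose_mat A) * W * transpose_mat W;
         X' = fst (qr (u1 * W));
         u2 = - (X' * transpose_mat X' *
                 ((L1 Nx - 2 \<cdot>\<^sub>m 1\<^sub>m Nx) * u1 - L2 Nx dt * u1 * transpose_mat A)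
                 * W * transpose_mat W);
         u3 = X' * transpose_mat X' * (L1 Nx * u2 - L2 Nx dt * u2 * transpose_mat A)
     in u3)"

text \<open>
  A scheme maps the number of cells, the time step size and the factors \<open>X\<close>, \<open>S\<close>,
  \<open>W\<close> to the new solution.  The ratio \<open>\<rho>\<close> of time step size to cell width is kept
  fixed while the number of cells varies; \<open>n\<close> is the number of columns of a solution.
\<close>

definition L2_stable ::
  "nat \<Rightarrow> nat \<Rightarrow> real \<Rightarrow>
   (nat \<Rightarrow> real \<Rightarrow> real mat \<Rightarrow> real mat \<Rightarrow> real mat \<Rightarrow> real mat) \<Rightarrow> bool" where
  "L2_stable n r \<rho> scheme \<longleftrightarrow>
     (\<forall>Nx dt X S W. Nx \<ge> r \<longrightarrow> dt > 0 \<longrightarrow> dt / cell_width Nx = \<rho> \<longrightarrow>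
        X \<in> carrier_mat Nx r \<longrightarrow> orthonormal_cols X \<longrightarrow>
        S \<in> carrier_mat r r \<longrightarrow>
        W \<in> carrier_mat n r \<longrightarrow> orthonormal_cols W \<longrightarrow>
        frob_norm (scheme Nx dt X S W) \<le> frob_norm (X * S * transpose_mat W))"

abbreviation L2_unstable ::
  "nat \<Rightarrow> nat \<Rightarrow> real \<Rightarrow>
   (nat \<Rightarrow> real \<Rightarrow> real mat \<Rightarrow> real mat \<Rightarrow> real mat \<Rightarrow> real mat) \<Rightarrow> bool" where
  "L2_unstable n r \<rho> scheme \<equiv> \<not> L2_stable n r \<rho> scheme"

end

theory Submission
  imports Defs
begin

text \<open>
  The instability comes from the highest frequency on the grid, which the central difference
  cannot see, so that no choice of \<open>A\<close> or of the time step prevents it.  For an even number of cells the checkerboard mode \<open>v\<^sub>j = (-1)\<^sup>j\<close> satisfies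
  \<open>L1 v = -v\<close>, and the central difference \<open>L2 v\<close> vanishes because both neighbours of a cell
  carry the same value.  For a solution \<open>u\<close> all of whose columns are multiples of \<open>v\<close>, the
  scheme therefore reduces to scalar multiplications, provided the projections leave \<open>u\<close>
  unchanged.  The projection onto the range of \<open>W\<close> does so because \<open>u = X S W\<^sup>T\<close>, and
  the one onto the range of \<open>X'\<close> does so because the QR factor \<open>X'\<close> spans the columns of
  \<open>u\<^sub>I W\<close>.  The three substeps multiply \<open>u\<close> by the factors
  \<open>-1\<close>, \<open>-(-1 - 2) = 3\<close> and \<open>-1\<close>: the backward substep amplifies by 3 the mode
  that the two forward substeps leave undamped.  Hence the norm grows by the factor 3
  (\<open>psi_lax_friedrichs_triples\<close>).

  The argument needs only that some nonzero \<open>u\<close> of this kind has a representation of rank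
  parameter \<open>r\<close>.  The factor \<open>S\<close> may be singular, so on \<open>2 r\<close> cells it is enough to
  write \<open>v\<close> as a sum of \<open>r\<close> orthogonal differences of adjacent cells and let \<open>S\<close> have
  rank one.
\<close>

section \<open>Orthonormal columns and range projections\<close>

lemma orthonormal_cols_gram:
  assumes M: "M \<in> carrier_mat m n" and "orthonormal_cols M"
  shows "transpose_mat M * M = 1\<^sub>m n"
  using assms by (intro eq_matI) (auto simp: orthonormal_cols_def)

text \<open>
  The range of \<open>Q\<close> contains that of \<open>K\<close> even if \<open>K\<close> is rank-deficient, which is what
  makes the choice of the QR decomposition irrelevant.
\<close>

lemma QR_projection_fixes:
  assumes "is_QR K Q R" and K: "K \<in> carrier_mat m r"
  shows "Q * transpose_mat Q * K = K"
proof -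
  from assms have Q: "Q \<in> carrier_mat m r" and R: "R \<in> carrier_mat r r"
    and orth: "orthonormal_cols Q" and eq: "K = Q * R"
    by (auto simp: is_QR_def)
  have "Q * transpose_mat Q * (Q * R) = Q * (transpose_mat Q * (Q * R))"
    using Q R by (intro assoc_mult_mat) auto
  also have "transpose_mat Q * (Q * R) = transpose_mat Q * Q * R"
    using Q R by (intro assoc_mult_mat[symmetric]) auto
  also have "\<dots> = R" using orthonormal_cols_gram[OF Q orth] R by simp
  finally show ?thesis using eq by simp
qed

section \<open>The checkerboard mode\<close>

text \<open>
  A row of either stencil has two entries, which coincide on at most two cells; splitting the
  sum into two indicator sums covers that case as well.
\<close>

lemma sum_neighbours:
  fixes f :: "nat \<Rightarrow> real"
  assumes "p < n" "q < n"
  shows "(\<Sum>k<n. c * (of_bool (k = p) + of_bool (k = q)) * f k) = c * (f p + f q)"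
    and "(\<Sum>k<n. c * (of_bool (k = p) - of_bool (k = q)) * f k) = c * (f p - f q)"
proof -
  have split: "(\<Sum>k<n. of_bool (k = s) * f k) = f s" if "s < n" for s
  proof -
    have "(\<Sum>k<n. of_bool (k = s) * f k) = (\<Sum>k<n. if k = s then f k else 0)"
      by (rule sum.cong) auto
    then show ?thesis using that by simp
  qed
  show "(\<Sum>k<n. c * (of_bool (k = p) + of_bool (k = q)) * f k) = c * (f p + f q)"
    using split[OF assms(1)] split[OF assms(2)]
    by (simp add: ring_distribs sum.distrib sum_distrib_left[symmetric] mult.assoc)
  show "(\<Sum>k<n. c * (of_bool (k = p) - of_bool (k = q)) * f k) = c * (f p - f q)"
    using split[OF assms(1)] split[OF assms(2)]
    by (simp add: ring_distribs left_diff_distrib right_diff_distrib sum_subtractf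
        sum_distrib_left[symmetric] mult.assoc)
qed

text \<open>
  On an even periodic grid the wrap-around preserves parity, so both neighbours of a cell have
  the opposite sign: averaging them flips the sign, and their difference is zero.
\<close>

lemma stencils_checkerboard:
  fixes b :: "nat \<Rightarrow> real" and Nx m :: nat
  assumes "even Nx"
  defines "B \<equiv> mat Nx m (\<lambda>(i, j). (-1) ^ i * b j)"
  shows "L1 Nx * B = - B" and "L2 Nx dt * B = 0\<^sub>m Nx m"
proof -
  have right: "(-1 :: real) ^ ((i + 1) mod Nx) = - ((-1) ^ i)" for i
    using assms(1) by (simp add: minus_one_power_iff dvd_mod_iff)
  have left: "(-1 :: real) ^ ((i + Nx - 1) mod Nx) = - ((-1) ^ i)" if "i < Nx" for i
    using assms(1) that by (simp add: minus_one_power_iff dvd_mod_iff)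
  show "L1 Nx * B = - B"
  proof (intro eq_matI)
    fix i j assume "i < dim_row (- B)" "j < dim_col (- B)"
    then have ij: "i < Nx" "j < m" by (auto simp: B_def)
    then have lt: "(i + 1) mod Nx < Nx" "(i + Nx - 1) mod Nx < Nx" by auto
    have "(L1 Nx * B) $$ (i, j) = (\<Sum>k<Nx. 1 / 2 * (of_bool (k = (i + 1) mod Nx)
        + of_bool (k = (i + Nx - 1) mod Nx)) * ((-1) ^ k * b j))"
      using ij by (auto simp: L1_def B_def scalar_prod_def atLeast0LessThan intro!: sum.cong)
    also have "\<dots> = - ((-1) ^ i * b j)"
      unfolding sum_neighbours(1)[OF lt] right left[OF ij(1)] by simp
    finally show "(L1 Nx * B) $$ (i, j) = (- B) $$ (i, j)" using ij by (simp add: B_def)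
  qed (auto simp: L1_def B_def)
  show "L2 Nx dt * B = 0\<^sub>m Nx m"
  proof (intro eq_matI)
    fix i j assume "i < dim_row (0\<^sub>m Nx m :: real mat)" "j < dim_col (0\<^sub>m Nx m :: real mat)"
    then have ij: "i < Nx" "j < m" by auto
    then have lt: "(i + 1) mod Nx < Nx" "(i + Nx - 1) mod Nx < Nx" by auto
    have "(L2 Nx dt * B) $$ (i, j) = (\<Sum>k<Nx. dt / (2 * cell_width Nx) *
        (of_bool (k = (i + 1) mod Nx) - of_bool (k = (i + Nx - 1) mod Nx)) * ((-1) ^ k * b j))"
      using ij by (auto simp: L2_def B_def scalar_prod_def atLeast0LessThan intro!: sum.cong)
    also have "\<dots> = 0"
      unfolding sum_neighbours(2)[OF lt] right left[OF ij(1)] by simp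
    finally show "(L2 Nx dt * B) $$ (i, j) = 0\<^sub>m Nx m $$ (i, j)" using ij by simp
  qed (auto simp: L2_def B_def)
qed

section \<open>Amplification of the checkerboard mode\<close>

text \<open>
  The hypotheses on \<open>X * S\<close> pass to \<open>u = X S W\<^sup>T\<close>, because the stencils act from the
  left.  Both projections fix \<open>u\<close>, so every intermediate result is a multiple of \<open>u\<close>,
  with factors \<open>-1\<close>, \<open>-3\<close> and \<open>3\<close> after the three substeps.
\<close>

lemma psi_lax_friedrichs_triples:
  assumes A: "A \<in> carrier_mat n n" and qr: "QR_routine qr" and "r \<le> Nx"
    and X: "X \<in> carrier_mat Nx r" and S: "S \<in> carrier_mat r r"
    and W: "W \<in> carrier_mat n r" and orth: "orthonormal_cols W"
    and eig: "L1 Nx * (X * S) = - (X * S)" and ker: "L2 Nx dt * (X * S) = 0\<^sub>m Nx r"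
  shows "psi_lax_friedrichs A qr Nx dt X S W = 3 \<cdot>\<^sub>m (X * S * transpose_mat W)"
proof -
  define u where "u = X * S * transpose_mat W"
  define Q where "Q = fst (qr (- u * W))"
  have XS: "X * S \<in> carrier_mat Nx r" and Wt: "transpose_mat W \<in> carrier_mat r n"
    using X S W by auto
  have u: "u \<in> carrier_mat Nx n" unfolding u_def using XS Wt by auto
  have L1c: "L1 Nx \<in> carrier_mat Nx Nx" and L2c: "L2 Nx dt \<in> carrier_mat Nx Nx"
    by (auto simp: L1_def L2_def)
  have At: "transpose_mat A \<in> carrier_mat n n" using A by auto
  have L1u: "L1 Nx * u = - u"
    unfolding u_def using assoc_mult_mat[OF L1c XS Wt] eig XS Wt by (metis carrier_matD uminus_mult_left_mat)
  have L2u: "L2 Nx dt * u = 0\<^sub>m Nx n"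
    unfolding u_def using assoc_mult_mat[OF L2c XS Wt] ker XS Wt by simp
  have uW: "u * W = X * S"
    unfolding u_def using assoc_mult_mat[OF XS Wt W] orthonormal_cols_gram[OF W orth]
      right_mult_one_mat[OF XS] by simp
  have uWW: "u * W * transpose_mat W = u" unfolding uW by (simp add: u_def)
  have K: "- u * W \<in> carrier_mat Nx r" using u W by auto
  have "is_QR (- u * W) Q (snd (qr (- u * W)))"
    using qr K \<open>r \<le> Nx\<close> unfolding QR_routine_def Q_def by auto
  from QR_projection_fixes[OF this K] this K
  have projK: "Q * transpose_mat Q * (- u * W) = - u * W" and Q: "Q \<in> carrier_mat Nx r"
    using u W by (auto simp: is_QR_def)
  have P: "Q * transpose_mat Q \<in> carrier_mat Nx Nx" using Q by auto
  have "Q * transpose_mat Q * (- u * W) = - (Q * transpose_mat Q * (u * W))"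
    using Q u W by simp
  with projK have "Q * transpose_mat Q * (u * W) = u * W"
    using u W by (simp add: uminus_eq_mat)
  then have Pu: "Q * transpose_mat Q * u = u"
    using assoc_mult_mat[OF P _ Wt, of "u * W"] u W uWW by simp
  \<comment> \<open>The substeps act on multiples of \<open>u\<close>, so each is evaluated on \<open>c u\<close>.\<close>
  have step: "L1 Nx * (c \<cdot>\<^sub>m u) - L2 Nx dt * (c \<cdot>\<^sub>m u) * transpose_mat A = (- c) \<cdot>\<^sub>m u" for c
    using u At L1c L2c L1u L2u
    by (auto simp: mult_smult_distrib[of _ Nx Nx _ n] intro!: eq_matI)
  have "(L1 Nx - 2 \<cdot>\<^sub>m 1\<^sub>m Nx) * (c \<cdot>\<^sub>m u) = L1 Nx * (c \<cdot>\<^sub>m u) - 2 \<cdot>\<^sub>m 1\<^sub>m Nx * (c \<cdot>\<^sub>m u)" for c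
    using u L1c by (intro minus_mult_distrib_mat[of _ Nx Nx]) auto
  then have backward_step: "(L1 Nx - 2 \<cdot>\<^sub>m 1\<^sub>m Nx) * (c \<cdot>\<^sub>m u) - L2 Nx dt * (c \<cdot>\<^sub>m u) * transpose_mat A
      = (- 3 * c) \<cdot>\<^sub>m u" for c
    using u At L1c L2c L1u L2u
    by (auto simp: mult_smult_distrib[of _ Nx Nx _ n] mult_smult_assoc_mat[of _ Nx Nx _ n]
        intro!: eq_matI)
  have WW: "(c \<cdot>\<^sub>m u) * W * transpose_mat W = c \<cdot>\<^sub>m u" for c
    using u W Wt uWW by (simp add: mult_smult_assoc_mat[of _ Nx n _ r] mult_smult_assoc_mat[of _ Nx r _ n])
  have PP: "Q * transpose_mat Q * (c \<cdot>\<^sub>m u) = c \<cdot>\<^sub>m u" for c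
    using mult_smult_distrib[OF P u, of c] Pu by simp
  have neg: "- (c \<cdot>\<^sub>m u) = (- c) \<cdot>\<^sub>m u" for c by (intro eq_matI) auto
  have one: "u = 1 \<cdot>\<^sub>m u" by (intro eq_matI) auto
  have u1: "(L1 Nx * u - L2 Nx dt * u * transpose_mat A) * W * transpose_mat W = (- 1) \<cdot>\<^sub>m u"
    using step[of 1] WW[of "- 1"] one by simp
  have u1': "(- 1) \<cdot>\<^sub>m u = - u" by (intro eq_matI) auto
  have QX: "fst (qr ((- 1) \<cdot>\<^sub>m u * W)) = Q" unfolding Q_def u1' ..
  have u2: "- (Q * transpose_mat Q * ((L1 Nx - 2 \<cdot>\<^sub>m 1\<^sub>m Nx) * ((- 1) \<cdot>\<^sub>m u)
      - L2 Nx dt * ((- 1) \<cdot>\<^sub>m u) * transpose_mat A) * W * transpose_mat W) = (- 3) \<cdot>\<^sub>m u"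
    unfolding backward_step PP WW neg by simp
  show ?thesis
    unfolding psi_lax_friedrichs_def Let_def u_def[symmetric] u1 QX u2 step PP by simp
qed

lemma frob_norm_smult: "frob_norm (c \<cdot>\<^sub>m M) = \<bar>c\<bar> * frob_norm M"
  by (simp add: frob_norm_def power_mult_distrib sum_distrib_left[symmetric] real_sqrt_mult)

lemma frob_norm_pos:
  assumes "i < dim_row M" "j < dim_col M" "M $$ (i, j) \<noteq> 0"
  shows "frob_norm M > 0"
proof -
  have "0 < (\<Sum>j<dim_col M. (M $$ (i, j))\<^sup>2)"
    using assms by (intro sum_pos2[of _ j]) auto
  then have "0 < (\<Sum>i<dim_row M. \<Sum>j<dim_col M. (M $$ (i, j))\<^sup>2)"
    using assms by - (rule sum_pos2[of _ i], auto intro: sum_nonneg)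
  then show ?thesis by (simp add: frob_norm_def)
qed

section \<open>Instability\<close>

text \<open>
  The columns \<open>(e\<^sub>2\<^sub>k - e\<^sub>2\<^sub>k\<^sub>+\<^sub>1) / \<surd>2\<close> have disjoint supports.
\<close>

lemma orthonormal_adjacent_differences:
  "orthonormal_cols (mat (2 * r) r (\<lambda>(i, k). of_bool (i div 2 = k) * (-1) ^ i / sqrt 2))"
proof -
  have "(\<Sum>i<2 * m. of_bool (i div 2 = k) * (-1) ^ i / sqrt 2 *
      (of_bool (i div 2 = l) * (-1) ^ i / sqrt 2)) = (of_bool (k = l \<and> k < m) :: real)" for m k l
    by (induction m) auto
  then show ?thesis
    by (auto simp: orthonormal_cols_def scalar_prod_def atLeast0LessThan)
qed

theorem theorem1:
  fixes N r :: nat and A :: "real mat" and \<rho> :: real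
    and qr :: "real mat \<Rightarrow> real mat \<times> real mat"
  assumes "A \<in> carrier_mat (N + 1) (N + 1)"
    and "1 \<le> r" and "r \<le> N + 1"
    and "\<rho> > 0"
    and "QR_routine qr"
  shows "L2_unstable (N + 1) r \<rho> (psi_lax_friedrichs A qr)"
proof
  assume stable: "L2_stable (N + 1) r \<rho> (psi_lax_friedrichs A qr)"
  define dt where "dt = \<rho> * cell_width (2 * r)"
  define X :: "real mat" where
    "X = mat (2 * r) r (\<lambda>(i, k). of_bool (i div 2 = k) * (-1) ^ i / sqrt 2)"
  define S :: "real mat" where "S = mat r r (\<lambda>(k, j). of_bool (j = 0))"
  define W :: "real mat" where "W = mat (N + 1) r (\<lambda>(i, j). of_bool (i = j))"
  have cw: "cell_width (2 * r) > 0" using assms(2) by (simp add: cell_width_def)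
  have X: "X \<in> carrier_mat (2 * r) r" and S: "S \<in> carrier_mat r r"
    and W: "W \<in> carrier_mat (N + 1) r"
    by (auto simp: X_def S_def W_def)
  have oX: "orthonormal_cols X" unfolding X_def by (rule orthonormal_adjacent_differences)
  have oW: "orthonormal_cols W"
    using assms(3) by (auto simp: orthonormal_cols_def W_def scalar_prod_def of_bool_def
        if_distrib[of "\<lambda>x. x * _"] cong: if_cong)
  \<comment> \<open>Each cell lies in the support of exactly one column of \<open>X\<close>, so the first column of
    \<open>X * S\<close> is the checkerboard mode.\<close>
  have XS: "X * S = mat (2 * r) r (\<lambda>(i, j). (-1) ^ i * (of_bool (j = 0) / sqrt 2))"
  proof (intro eq_matI)
    fix i j assume "i < dim_row (mat (2 * r) r (\<lambda>(i, j). (-1) ^ i * (of_bool (j = 0) / sqrt 2) :: real))"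
      "j < dim_col (mat (2 * r) r (\<lambda>(i, j). (-1) ^ i * (of_bool (j = 0) / sqrt 2) :: real))"
    then have ij: "i < 2 * r" "j < r" by auto
    have "(X * S) $$ (i, j) =
        (\<Sum>k<r. of_bool (i div 2 = k) * ((-1) ^ i * (of_bool (j = 0) / sqrt 2)))"
      using ij by (auto simp: X_def S_def scalar_prod_def atLeast0LessThan intro!: sum.cong)
    also have "\<dots> = (-1) ^ i * (of_bool (j = 0) / sqrt 2)"
      using ij unfolding sum_distrib_right[symmetric]
      by (simp add: of_bool_def less_mult_imp_div_less mult.commute[of 2])
    finally show "(X * S) $$ (i, j) =
        mat (2 * r) r (\<lambda>(i, j). (-1) ^ i * (of_bool (j = 0) / sqrt 2)) $$ (i, j)"
      using ij by simp
  qed (auto simp: X_def S_def)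
  have triple: "psi_lax_friedrichs A qr (2 * r) dt X S W = 3 \<cdot>\<^sub>m (X * S * transpose_mat W)"
    using stencils_checkerboard[where Nx = "2 * r" and m = r and b = "\<lambda>j. of_bool (j = 0) / sqrt 2"]
    by (intro psi_lax_friedrichs_triples[OF assms(1,5) _ X S W oW]) (auto simp: XS)
  have "(X * S * transpose_mat W) $$ (0, 0) = (\<Sum>k<r. of_bool (k = 0) / sqrt 2)"
    using assms(2,3) unfolding XS
    by (auto simp: W_def scalar_prod_def atLeast0LessThan intro!: sum.cong)
  also have "\<dots> = 1 / sqrt 2"
    using assms(2) by (simp add: of_bool_def if_distrib[of "\<lambda>x. x / _"] cong: if_cong)
  finally have "frob_norm (X * S * transpose_mat W) > 0"
    using assms(2) X W by (intro frob_norm_pos[of 0 _ 0]) auto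
  moreover have "frob_norm (psi_lax_friedrichs A qr (2 * r) dt X S W)
      \<le> frob_norm (X * S * transpose_mat W)"
    using stable X S W oX oW cw assms(4) unfolding L2_stable_def by (simp add: dt_def)
  ultimately show False by (simp add: triple frob_norm_smult)
qed

end
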